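(* Let $T,U\in GL(H)$, and let $\Lambda=\{\Lambda_i\in L(H,H_i)\}_{i\in I}$ and $\Gamma=\{\Gamma_i\in L(H,H_i)\}_{i\in I}$ be a $(T,T)$-controlled g-Bessel sequence and a $(U,U)$-controlled g-Bessel sequence, respectively. Define $S_{T\Gamma\Lambda U}f=\sum_{i\in I}U^*\Gamma_i^*\Lambda_iTf$ for $f\in H$. Suppose there exists $0<\varepsilon<1$ such that $$\|f-S_{T\Gamma\Lambda U}f\|\le\varepsilon\|f\|\qquad\text{for all } f\in H .$$ Then $\Lambda$ is a $(T,T)$-controlled g-frame for $H$ and $\Gamma$ is a $(U,U)$-controlled g-frame for $H$. Furthermore, $S_{T\Gamma\Lambda U}$ is invertible.
   Context: $H$ is a separable Hilbert space, $I\subset\mathbb Z$, and $\{H_i\}_{i\in I}$ is a family of Hilbert spaces. $L(H,H_i)$ is the set of bounded linear operators $H\to H_i$; $GL(H)$ is the set of bounded linear operators on $H$ with bounded inverse. For $T\in GL(H)$, a family $\{\Lambda_i\in L(H,H_i)\}_{i\in I}$ is a $(T,T)$-controlled g-Bessel sequence with bound $B<\infty$ if $\sum_{i\in I}\|\Lambda_iTf\|^2\le B\|f\|^2$ for all $f\in H$; it is a $(T,T)$-controlled g-frame for $H$ if it is a g-Bessel sequence (i.e. $\sum_{i\in I}\|\Lambda_if\|^2\le D\|f\|^2$ for all $f\in H$, for some $D<\infty$) and there exist $0<A\le B<\infty$ with $A\|f\|^2\le\sum_{i\in I}\|\Lambda_iTf\|^2\le B\|f\|^2$ for all $f\in H$.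 For controlled g-Bessel sequences as in the claim, the series defining $S_{T\Gamma\Lambda U}$ converges and defines a bounded operator on $H$. *)

theory Defs
  imports "HOL-Analysis.Analysis" "HOL-Algebra.Module"
begin

text \<open>
  A family of Hilbert spaces has spaces of varying carrier, addition, scalar multiplication and
  inner product, so a Hilbert space is a record with explicit carrier, extending the record of
  modules of HOL-Algebra. (The multiplication and unit that this record inherits from rings are
  never used.) The scalar field is either the reals or the complex numbers; real scalars are
  represented as a subset of the complex ones. Operators are HOL functions that are only ever
  considered on the carrier.
\<close>

record 'a ip_module = "(complex, 'a) module" +
  ip :: "'a \<Rightarrow> 'a \<Rightarrow> complex"

definition scalar_ring :: "complex set \<Rightarrow> complex ring" where
  "scalar_ring K = \<lparr>carrier = K, mult = (*), one = 1, zero = 0, add = (+)\<rparr>"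

definition hnorm :: "'a ip_module \<Rightarrow> 'a \<Rightarrow> real" where
  "hnorm H x = sqrt (Re (ip H x x))"

text \<open>The locale \<open>Metric_space\<close> requires symmetry and nonnegativity of the distance outside the
  carrier too, hence the case distinction.\<close>

definition hdist :: "'a ip_module \<Rightarrow> 'a \<Rightarrow> 'a \<Rightarrow> real" where
  "hdist H x y = (if x \<in> carrier H \<and> y \<in> carrier H then hnorm H (x \<ominus>\<^bsub>H\<^esub> y) else 0)"

abbreviation htopology :: "'a ip_module \<Rightarrow> 'a topology" where
  "htopology H \<equiv> Metric_space.mtopology (carrier H) (hdist H)"

locale inner_product_space = module "scalar_ring K" H
  for K :: "complex set" and H :: "'a ip_module" (structure) +
  assumes scalars: "K = \<real> \<or> K = UNIV"
    and ip_closed: "\<lbrakk>x \<in> carrier H; y \<in> carrier H\<rbrakk> \<Longrightarrow> ip H x y \<in> K"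
    and ip_commute: "\<lbrakk>x \<in> carrier H; y \<in> carrier H\<rbrakk> \<Longrightarrow> ip H y x = cnj (ip H x y)"
    and ip_add_left: "\<lbrakk>x \<in> carrier H; y \<in> carrier H; z \<in> carrier H\<rbrakk> \<Longrightarrow>
      ip H (x \<oplus> y) z = ip H x z + ip H y z"
    and ip_smult_left: "\<lbrakk>c \<in> K; x \<in> carrier H; y \<in> carrier H\<rbrakk> \<Longrightarrow>
      ip H (c \<odot>\<^bsub>H\<^esub> x) y = c * ip H x y"
    and ip_nonneg: "x \<in> carrier H \<Longrightarrow> 0 \<le> Re (ip H x x)"
    and ip_definite: "\<lbrakk>x \<in> carrier H; ip H x x = 0\<rbrakk> \<Longrightarrow> x = \<zero>"

text \<open>Cauchy--Schwarz and the triangle inequality, so that \<open>hdist\<close> is indeed a metric on the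
  carrier and the constants of \<open>Metric_space\<close> used here have their intended meaning.\<close>

context inner_product_space begin

lemma K_carrier [simp]: "carrier (scalar_ring K) = K" by (simp add: scalar_ring_def)
lemma K_closed: "a \<in> K \<Longrightarrow> b \<in> K \<Longrightarrow> a * b \<in> K" "a \<in> K \<Longrightarrow> b \<in> K \<Longrightarrow> a / b \<in> K" "a \<in> K \<Longrightarrow> - a \<in> K"
  using scalars by auto

lemma ip_zero_left: "x \<in> carrier H \<Longrightarrow> ip H \<zero> x = 0"
  using ip_add_left[of \<zero> \<zero> x] by simp

lemma ip_zero_right: "x \<in> carrier H \<Longrightarrow> ip H x \<zero> = 0"
  using ip_commute[of \<zero> x] by (simp add: ip_zero_left)

lemma ip_neg_left:
  assumes "x \<in> carrier H" "y \<in> carrier H"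
  shows "ip H (\<ominus> x) y = - ip H x y"
proof -
  have "ip H x y + ip H (\<ominus> x) y = 0"
    using assms ip_add_left[of x "\<ominus> x" y] by (simp add: r_neg ip_zero_left)
  then show ?thesis by (simp add: add_eq_0_iff)
qed

lemma ip_add_right:
  assumes "x \<in> carrier H" "y \<in> carrier H" "z \<in> carrier H"
  shows "ip H z (x \<oplus> y) = ip H z x + ip H z y"
  using assms ip_commute[of "x \<oplus> y" z] ip_commute[of x z] ip_commute[of y z] by (simp only: ip_add_left a_closed complex_cnj_add)

lemma ip_neg_right:
  assumes "x \<in> carrier H" "y \<in> carrier H"
  shows "ip H y (\<ominus> x) = - ip H y x"
  using assms ip_commute[of "\<ominus> x" y] ip_commute[of x y] by (simp only: ip_neg_left a_inv_closed complex_cnj_minus)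

lemma smult_clos: "\<lbrakk>c \<in> K; x \<in> carrier H\<rbrakk> \<Longrightarrow> c \<odot>\<^bsub>H\<^esub> x \<in> carrier H"
  using smult_closed by simp

lemma ip_smult_right:
  assumes "c \<in> K" "x \<in> carrier H" "y \<in> carrier H"
  shows "ip H y (c \<odot>\<^bsub>H\<^esub> x) = cnj c * ip H y x"
  using assms ip_commute[of "c \<odot>\<^bsub>H\<^esub> x" y] ip_commute[of x y] by (simp only: ip_smult_left smult_clos complex_cnj_mult)

lemma ip_self:
  assumes "x \<in> carrier H" shows "ip H x x = of_real ((hnorm H x)\<^sup>2)"
proof -
  have "Im (ip H x x) = - Im (ip H x x)"
    using arg_cong[OF ip_commute[OF assms assms], of Im] by simp
  then show ?thesis using ip_nonneg[OF assms] by (simp add: hnorm_def complex_eq_iff)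
qed

lemma hnorm_nonneg: "x \<in> carrier H \<Longrightarrow> 0 \<le> hnorm H x"
  by (simp add: hnorm_def ip_nonneg)

lemma hnorm_zero_iff:
  assumes "x \<in> carrier H" shows "hnorm H x = 0 \<longleftrightarrow> x = \<zero>"
proof
  show "x = \<zero>" if "hnorm H x = 0" by (rule ip_definite[OF assms]) (simp add: ip_self[OF assms] that)
  show "hnorm H x = 0" if "x = \<zero>" using that by (simp add: hnorm_def ip_zero_left)
qed

lemma cauchy_schwarz:
  assumes x: "x \<in> carrier H" and y: "y \<in> carrier H"
  shows "cmod (ip H x y) \<le> hnorm H x * hnorm H y"
proof (cases "y = \<zero>")
  case True then show ?thesis using x y by (simp add: ip_zero_right hnorm_nonneg)
next
  case False
  define n where "n = hnorm H y"
  have n: "n > 0" using False y hnorm_nonneg[of y] hnorm_zero_iff[of y] by (simp add: n_def)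
  define c where "c = ip H x y / ip H y y"
  have c: "c \<in> K" using ip_closed x y by (auto simp: c_def K_closed)
  define z where "z = \<ominus> (c \<odot>\<^bsub>H\<^esub> y)"
  have z: "z \<in> carrier H" using c y by (simp add: z_def smult_clos)
  have cc: "c = ip H x y / of_real (n\<^sup>2)" by (simp add: c_def ip_self[OF y] n_def)
  have "ip H (x \<oplus> z) (x \<oplus> z) = ip H x x - cnj c * ip H x y - c * ip H y x + c * cnj c * ip H y y"
    using x y z c by (simp add: ip_add_left ip_add_right z_def ip_neg_left ip_neg_right smult_clos
      ip_smult_left ip_smult_right algebra_simps)
  also have "ip H y x = cnj (ip H x y)" by (rule ip_commute[OF x y])
  also have "ip H x x = of_real ((hnorm H x)\<^sup>2)" by (rule ip_self[OF x])
  also have "ip H y y = of_real (n\<^sup>2)" by (simp add: ip_self[OF y] n_def)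
  finally have e: "ip H (x \<oplus> z) (x \<oplus> z) = of_real ((hnorm H x)\<^sup>2) - (ip H x y * cnj (ip H x y)) / of_real (n\<^sup>2)"
    unfolding cc using n by (simp add: power2_eq_square)
  have "0 \<le> Re (ip H (x \<oplus> z) (x \<oplus> z))" using x z ip_nonneg by simp
  also have "\<dots> = (hnorm H x)\<^sup>2 - (cmod (ip H x y))\<^sup>2 / n\<^sup>2"
    
  proof -
    have "ip H (x \<oplus> z) (x \<oplus> z) = of_real ((hnorm H x)\<^sup>2 - (cmod (ip H x y))\<^sup>2 / n\<^sup>2)"
      unfolding e by (simp only: complex_norm_square[symmetric] of_real_diff of_real_divide)
    then show ?thesis by (simp only: Re_complex_of_real)
  qed
  finally have "(cmod (ip H x y))\<^sup>2 \<le> (hnorm H x * n)\<^sup>2" using n by (simp add: field_simps)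
  then show ?thesis unfolding n_def by (rule power2_le_imp_le) (simp add: hnorm_nonneg x y)
qed

lemma hnorm_triangle:
  assumes x: "x \<in> carrier H" and y: "y \<in> carrier H"
  shows "hnorm H (x \<oplus> y) \<le> hnorm H x + hnorm H y"
proof -
  have "ip H (x \<oplus> y) (x \<oplus> y) = ip H x x + ip H x y + cnj (ip H x y) + ip H y y"
    using x y by (simp add: ip_add_left ip_add_right ip_commute[OF x y])
  then have "(hnorm H (x \<oplus> y))\<^sup>2 = (hnorm H x)\<^sup>2 + 2 * Re (ip H x y) + (hnorm H y)\<^sup>2"
    using x y ip_nonneg[of "x \<oplus> y"] by (simp add: hnorm_def ip_nonneg)
  also have "\<dots> \<le> (hnorm H x + hnorm H y)\<^sup>2"
    using cauchy_schwarz[OF x y] complex_Re_le_cmod[of "ip H x y"] by (simp add: power2_sum)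
  finally show ?thesis using hnorm_nonneg x y by (metis add_nonneg_nonneg power2_le_imp_le)
qed

lemma hnorm_minus: "x \<in> carrier H \<Longrightarrow> hnorm H (\<ominus> x) = hnorm H x"
  by (simp add: hnorm_def ip_neg_left ip_neg_right)

lemma Metric_space_hdist: "Metric_space (carrier H) (hdist H)"
proof
  show "0 \<le> hdist H x y" for x y by (simp add: hdist_def hnorm_nonneg)
  show "hdist H x y = hdist H y x" for x y
    using hnorm_minus[of "x \<ominus> y"] by (auto simp: hdist_def minus_eq minus_add a_comm)
  show "(hdist H x y = 0) = (x = y)" if "x \<in> carrier H" "y \<in> carrier H" for x y
    using that by (simp add: hdist_def hnorm_zero_iff) (metis minus_equality a_inv_closed minus_eq minus_minus r_neg l_neg a_comm)
  show "hdist H x z \<le> hdist H x y + hdist H y z" if "x \<in> carrier H" "y \<in> carrier H" "z \<in> carrier H" for x y z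
  proof -
    have "x \<ominus> z = (x \<ominus> y) \<oplus> (y \<ominus> z)" using that
      by (simp add: minus_eq a_assoc) (metis a_assoc a_inv_closed l_neg l_zero)
    then show ?thesis using that hnorm_triangle[of "x \<ominus> y" "y \<ominus> z"] by (simp add: hdist_def)
  qed
qed
end

locale hilbert_space = inner_product_space +
  assumes complete: "Metric_space.mcomplete (carrier H) (hdist H)"

definition bounded_ops :: "complex set \<Rightarrow> 'a ip_module \<Rightarrow> 'b ip_module \<Rightarrow> ('a \<Rightarrow> 'b) set" where
  "bounded_ops K G H = {A. A \<in> carrier G \<rightarrow> carrier H \<and>
     (\<forall>x\<in>carrier G. \<forall>y\<in>carrier G. A (x \<oplus>\<^bsub>G\<^esub> y) = A x \<oplus>\<^bsub>H\<^esub> A y) \<and>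
     (\<forall>c\<in>K. \<forall>x\<in>carrier G. A (c \<odot>\<^bsub>G\<^esub> x) = c \<odot>\<^bsub>H\<^esub> A x) \<and>
     (\<exists>C. \<forall>x\<in>carrier G. hnorm H (A x) \<le> C * hnorm G x)}"

definition GL :: "complex set \<Rightarrow> 'a ip_module \<Rightarrow> ('a \<Rightarrow> 'a) set" where
  "GL K H = {A \<in> bounded_ops K H H.
     \<exists>B\<in>bounded_ops K H H. \<forall>x\<in>carrier H. B (A x) = x \<and> A (B x) = x}"

definition hadjoint :: "'a ip_module \<Rightarrow> 'b ip_module \<Rightarrow> ('a \<Rightarrow> 'b) \<Rightarrow> 'b \<Rightarrow> 'a" where
  "hadjoint G H A y = (THE x. x \<in> carrier G \<and> (\<forall>z\<in>carrier G. ip H (A z) y = ip G z x))"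

text \<open>Sums of families of vectors are limits, in the norm topology, of the net of finite partial
  sums; this is the analogue of \<open>infsum\<close> for a Hilbert space given by a record.\<close>

definition hsum :: "'a ip_module \<Rightarrow> ('i \<Rightarrow> 'a) \<Rightarrow> 'i set \<Rightarrow> 'a" where
  "hsum H f I = (THE s. limitin (htopology H) (\<lambda>F. \<Oplus>\<^bsub>H\<^esub>i\<in>F. f i) s (finite_subsets_at_top I))"

text \<open>In the following, \<open>E i\<close> is the Hilbert space in which \<open>\<Lambda> i\<close> takes its values. As the sum
  \<open>infsum\<close> of a divergent series is 0, convergence has to be stated separately.\<close>

definition g_upper_bound ::
  "'a ip_module \<Rightarrow> int set \<Rightarrow> (int \<Rightarrow> 'b ip_module) \<Rightarrow> (int \<Rightarrow> 'a \<Rightarrow> 'b) \<Rightarrow> real \<Rightarrow> bool" where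
  "g_upper_bound H I E \<Lambda> B \<longleftrightarrow> (\<forall>f\<in>carrier H.
     (\<lambda>i. (hnorm (E i) (\<Lambda> i f))\<^sup>2) summable_on I \<and>
     (\<Sum>\<^sub>\<infinity>i\<in>I. (hnorm (E i) (\<Lambda> i f))\<^sup>2) \<le> B * (hnorm H f)\<^sup>2)"

definition g_lower_bound ::
  "'a ip_module \<Rightarrow> int set \<Rightarrow> (int \<Rightarrow> 'b ip_module) \<Rightarrow> (int \<Rightarrow> 'a \<Rightarrow> 'b) \<Rightarrow> real \<Rightarrow> bool" where
  "g_lower_bound H I E \<Lambda> A \<longleftrightarrow> (\<forall>f\<in>carrier H.
     A * (hnorm H f)\<^sup>2 \<le> (\<Sum>\<^sub>\<infinity>i\<in>I. (hnorm (E i) (\<Lambda> i f))\<^sup>2))"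

definition g_bessel :: "complex set \<Rightarrow>
  'a ip_module \<Rightarrow> int set \<Rightarrow> (int \<Rightarrow> 'b ip_module) \<Rightarrow> (int \<Rightarrow> 'a \<Rightarrow> 'b) \<Rightarrow> bool" where
  "g_bessel K H I E \<Lambda> \<longleftrightarrow>
     (\<forall>i\<in>I. \<Lambda> i \<in> bounded_ops K H (E i)) \<and> (\<exists>D. g_upper_bound H I E \<Lambda> D)"

definition controlled_g_bessel :: "complex set \<Rightarrow> 'a ip_module \<Rightarrow> int set \<Rightarrow>
  (int \<Rightarrow> 'b ip_module) \<Rightarrow> ('a \<Rightarrow> 'a) \<Rightarrow> (int \<Rightarrow> 'a \<Rightarrow> 'b) \<Rightarrow> bool" where
  "controlled_g_bessel K H I E T \<Lambda> \<longleftrightarrow>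
     (\<forall>i\<in>I. \<Lambda> i \<in> bounded_ops K H (E i)) \<and> (\<exists>B. g_upper_bound H I E (\<lambda>i. \<Lambda> i \<circ> T) B)"

definition controlled_g_frame :: "complex set \<Rightarrow> 'a ip_module \<Rightarrow> int set \<Rightarrow>
  (int \<Rightarrow> 'b ip_module) \<Rightarrow> ('a \<Rightarrow> 'a) \<Rightarrow> (int \<Rightarrow> 'a \<Rightarrow> 'b) \<Rightarrow> bool" where
  "controlled_g_frame K H I E T \<Lambda> \<longleftrightarrow> g_bessel K H I E \<Lambda> \<and>
     (\<exists>A B. 0 < A \<and> A \<le> B \<and>
        g_lower_bound H I E (\<lambda>i. \<Lambda> i \<circ> T) A \<and> g_upper_bound H I E (\<lambda>i. \<Lambda> i \<circ> T) B)"

text \<open>\<open>controlled_op H I E T \<Gamma> \<Lambda> U\<close> is the operator \<open>S\<close> with index \<open>T \<Gamma> \<Lambda> U\<close>.\<close>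

definition controlled_op :: "'a ip_module \<Rightarrow> int set \<Rightarrow> (int \<Rightarrow> 'b ip_module) \<Rightarrow>
  ('a \<Rightarrow> 'a) \<Rightarrow> (int \<Rightarrow> 'a \<Rightarrow> 'b) \<Rightarrow> (int \<Rightarrow> 'a \<Rightarrow> 'b) \<Rightarrow> ('a \<Rightarrow> 'a) \<Rightarrow> 'a \<Rightarrow> 'a" where
  "controlled_op H I E T \<Gamma> \<Lambda> U f =
     hsum H (\<lambda>i. hadjoint H H U (hadjoint H (E i) (\<Gamma> i) (\<Lambda> i (T f)))) I"

end

theory Submission
  imports Defs
begin

text \<open>
  Write $S$ for the operator with index $T \Gamma \Lambda U$ and put
  $a(f) = \sum_i \|\Lambda_i T f\|^2$ and $b(f) = \sum_i \|\Gamma_i U f\|^2$. Formally,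
  $\langle z, S f\rangle = \sum_i \langle \Gamma_i U z, \Lambda_i T f\rangle$, so the Cauchy--Schwarz
  inequality for families gives $|\langle z, S f\rangle| \le \sqrt{a(f)}\,\sqrt{b(z)}$. On the other
  hand $\|f - S f\| \le \varepsilon \|f\|$ implies
  $(1 - \varepsilon)\|f\|^2 \le \mathrm{Re}\,\langle f, S f\rangle$. Together,
  \[ (1 - \varepsilon)\,\|f\|^2 \le \sqrt{a(f)}\,\sqrt{b(f)}, \]
  an estimate that treats $\Lambda$ and $\Gamma$ alike: bounding one factor by its Bessel bound
  leaves a lower frame bound for the other (\<open>lower_bound_from_product\<close>). The uncontrolled Bessel
  bound follows on replacing $f$ by $T^{-1} f$ (\<open>g_bessel_if_controlled\<close>).

  Invertibility holds for every linear $S$ with $\|f - S f\| \le \varepsilon\|f\|$ and $\varepsilon < 1$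
  (\<open>near_identity_in_GL\<close>): $\|S f\| \ge (1 - \varepsilon)\|f\|$ yields injectivity and a bound for
  the inverse, and $S x = g$ says that $x$ is a fixed point of the contraction
  $x \mapsto g + (x - S x)$.

  It remains to justify the formula for $\langle z, S f\rangle$. Both the adjoints and the limit of
  the series are defined by descriptions, so their existence has to be proved. Both come from
  the Riesz representation theorem (\<open>riesz_representation\<close>), applied for the series to the
  functional $z \mapsto \sum_i \langle z, u_i\rangle$; the Bessel bound on $\Gamma$, uniform
  over the unit ball of $z$, then upgrades weak convergence to norm convergence (\<open>hsum_weak\<close>).
\<close>

section \<open>Geometry of inner product spaces\<close>

context inner_product_space begin

lemma real_scalar: "complex_of_real r \<in> K"
  using scalars by auto

lemma diff_closed: "x \<in> carrier H \<Longrightarrow> y \<in> carrier H \<Longrightarrow> x \<ominus> y \<in> carrier H"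
  by (simp add: minus_eq)

lemma add_diff_same: "x \<in> carrier H \<Longrightarrow> y \<in> carrier H \<Longrightarrow> x \<oplus> (y \<ominus> x) = y"
  by (simp add: minus_eq) (metis a_inv_closed a_comm a_assoc r_neg r_zero)

lemma ip_diff_left:
  "\<lbrakk>x \<in> carrier H; y \<in> carrier H; z \<in> carrier H\<rbrakk> \<Longrightarrow> ip H (x \<ominus> y) z = ip H x z - ip H y z"
  by (simp add: minus_eq ip_add_left ip_neg_left)

lemma ip_diff_right:
  "\<lbrakk>x \<in> carrier H; y \<in> carrier H; z \<in> carrier H\<rbrakk> \<Longrightarrow> ip H z (x \<ominus> y) = ip H z x - ip H z y"
  by (simp add: minus_eq ip_add_right ip_neg_right)

lemma eq_if_ip_eq:
  assumes x: "x \<in> carrier H" and y: "y \<in> carrier H"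
    and eq: "\<And>z. z \<in> carrier H \<Longrightarrow> ip H z x = ip H z y"
  shows "x = y"
proof -
  have d: "x \<ominus> y \<in> carrier H" using x y by (rule diff_closed)
  have "ip H (x \<ominus> y) (x \<ominus> y) = 0"
    using ip_diff_right[OF x y d] eq[OF d] by simp
  then have "x \<ominus> y = \<zero>" by (rule ip_definite[OF d])
  then show ?thesis using add_diff_same[OF y x] y by simp
qed

lemma norm_sq_add:
  assumes "x \<in> carrier H" "y \<in> carrier H"
  shows "(hnorm H (x \<oplus> y))\<^sup>2 = (hnorm H x)\<^sup>2 + 2 * Re (ip H x y) + (hnorm H y)\<^sup>2"
proof -
  have "Re (ip H (x \<oplus> y) (x \<oplus> y)) = Re (ip H x x) + 2 * Re (ip H x y) + Re (ip H y y)"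
    using assms by (simp add: ip_add_left ip_add_right ip_commute[of x y])
  then show ?thesis using assms by (simp add: ip_self)
qed

lemma norm_sq_diff:
  assumes "x \<in> carrier H" "y \<in> carrier H"
  shows "(hnorm H (x \<ominus> y))\<^sup>2 = (hnorm H x)\<^sup>2 - 2 * Re (ip H x y) + (hnorm H y)\<^sup>2"
  using norm_sq_add[of x "\<ominus> y"] assms by (simp add: minus_eq ip_neg_right hnorm_minus)

lemma hnorm_smult:
  assumes "c \<in> K" "x \<in> carrier H"
  shows "hnorm H (c \<odot>\<^bsub>H\<^esub> x) = cmod c * hnorm H x"
proof -
  have "ip H (c \<odot>\<^bsub>H\<^esub> x) (c \<odot>\<^bsub>H\<^esub> x) = (c * cnj c) * ip H x x"
    using assms by (simp add: ip_smult_left ip_smult_right smult_clos)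
  also have "\<dots> = of_real ((cmod c * hnorm H x)\<^sup>2)"
    using assms by (simp add: ip_self complex_norm_square[symmetric] power_mult_distrib)
  finally show ?thesis using assms by (simp add: hnorm_def[of H "c \<odot>\<^bsub>H\<^esub> x"] hnorm_nonneg)
qed

lemma ip_finsum_right:
  assumes z: "z \<in> carrier H"
  shows "finite F \<Longrightarrow> u \<in> F \<rightarrow> carrier H \<Longrightarrow> ip H z (\<Oplus>i\<in>F. u i) = (\<Sum>i\<in>F. ip H z (u i))"
proof (induction F rule: finite_induct)
  case empty then show ?case using z by (simp add: ip_zero_right)
next
  case (insert a F)
  then have "u \<in> F \<rightarrow> carrier H" "u a \<in> carrier H" by auto
  with insert z show ?case by (simp add: finsum_insert ip_add_right finsum_closed)
qed

end

section \<open>Riesz representation and adjoints\<close>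

text \<open>The first-order condition at a minimum: a quadratic in \<open>t\<close> without constant term that is
  nowhere negative has no linear term. It suffices to test it at \<open>t = - r / (q + 1)\<close>, which, unlike
  the vertex \<open>- r / q\<close>, also makes sense for \<open>q = 0\<close>.\<close>

lemma linear_term_vanishes:
  fixes q r :: real
  assumes q: "0 \<le> q" and nonneg: "\<And>t. 0 \<le> 2 * t * r + t\<^sup>2 * q"
  shows "r = 0"
proof -
  have "0 \<le> 2 * (- r / (q + 1)) * r + (- r / (q + 1))\<^sup>2 * q" by (rule nonneg)
  also have "\<dots> = - (r\<^sup>2 * (q + 2)) / (q + 1)\<^sup>2"
  proof -
    have "2 * (- r / p) * r + (- r / p)\<^sup>2 * (p - 1) = - (r\<^sup>2 * (p + 1)) / p\<^sup>2"
      if "p \<noteq> 0" for p :: real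
      using that by (simp add: field_simps power2_eq_square)
    from this[of "q + 1"] show ?thesis using q by (simp add: add_ac)
  qed
  finally have "r\<^sup>2 * (q + 2) \<le> 0"
    using q by (auto simp: divide_le_0_iff)
  then show ?thesis
    using q by (smt (verit) mult_nonneg_nonneg mult_pos_pos zero_less_power2)
qed

text \<open>The representing vector is the minimiser of $J(x) = \|x\|^2 - 2\,\mathrm{Re}\,\phi(x)$. A
  minimising sequence is Cauchy by the parallelogram law, and the derivative of \<open>J\<close> at the minimiser
  in direction \<open>z\<close> vanishes, which is the equation wanted, up to real parts. This avoids closed
  subspaces and orthogonal projections.\<close>

theorem (in hilbert_space) riesz_representation:
  assumes closed: "\<And>z. z \<in> carrier H \<Longrightarrow> \<phi> z \<in> K"
    and add: "\<And>x y. \<lbrakk>x \<in> carrier H; y \<in> carrier H\<rbrakk> \<Longrightarrow> \<phi> (x \<oplus> y) = \<phi> x + \<phi> y"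
    and smult: "\<And>c x. \<lbrakk>c \<in> K; x \<in> carrier H\<rbrakk> \<Longrightarrow> \<phi> (c \<odot>\<^bsub>H\<^esub> x) = c * \<phi> x"
    and bound: "\<And>x. x \<in> carrier H \<Longrightarrow> cmod (\<phi> x) \<le> C * hnorm H x"
  shows "\<exists>x\<in>carrier H. \<forall>z\<in>carrier H. \<phi> z = ip H z x"
proof -
  interpret M: Metric_space "carrier H" "hdist H" by (rule Metric_space_hdist)
  define J where "J x = (hnorm H x)\<^sup>2 - 2 * Re (\<phi> x)" for x
  define m where "m = Inf (J ` carrier H)"
  have Re_bound: "\<bar>Re (\<phi> x)\<bar> \<le> C * hnorm H x" if "x \<in> carrier H" for x
    using bound[OF that] abs_Re_le_cmod[of "\<phi> x"] by linarith
  have J_add: "J (x \<oplus> d) = J x + 2 * (Re (ip H x d) - Re (\<phi> d)) + (hnorm H d)\<^sup>2"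
    if "x \<in> carrier H" "d \<in> carrier H" for x d
    using that by (simp add: J_def norm_sq_add add)
  have "- C\<^sup>2 \<le> J x" if "x \<in> carrier H" for x
    using Re_bound[OF that] zero_le_power2[of "hnorm H x - C"]
    by (simp add: J_def power2_diff abs_le_iff) (simp add: mult.commute)
  then have bdd: "bdd_below (J ` carrier H)" by (auto intro!: bdd_belowI)
  have m_le: "m \<le> J x" if "x \<in> carrier H" for x
    unfolding m_def using bdd that by (simp add: cInf_lower)
  have "\<exists>x\<in>carrier H. J x < m + e" if "e > 0" for e
    using cInf_lessD[of "J ` carrier H" "m + e"] that zero_closed unfolding m_def by auto
  then have "\<exists>s. \<forall>n. s n \<in> carrier H \<and> J (s n) < m + inverse (real (Suc n))"
    by (intro choice) (auto simp: Bex_def)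
  then obtain s where s: "\<And>n. s n \<in> carrier H" and Js: "\<And>n. J (s n) < m + inverse (real (Suc n))"
    by blast
  \<comment> \<open>By the parallelogram law, the midpoint of two almost minimal points would have too small a
    value of \<open>J\<close> if they were far apart.\<close>
  have near: "(hnorm H (x \<ominus> y))\<^sup>2 \<le> 2 * (J x - m) + 2 * (J y - m)"
    if x: "x \<in> carrier H" and y: "y \<in> carrier H" for x y
  proof -
    define t where "t = (1/2 :: real)"
    define h where "h = complex_of_real t \<odot>\<^bsub>H\<^esub> (x \<oplus> y)"
    have h: "h \<in> carrier H" using x y by (simp add: h_def smult_clos real_scalar)
    have "(hnorm H h)\<^sup>2 = ((hnorm H x)\<^sup>2 + 2 * Re (ip H x y) + (hnorm H y)\<^sup>2) / 4"
      unfolding h_def using x y by (subst hnorm_smult[OF real_scalar])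
        (auto simp: t_def power_mult_distrib norm_sq_add power_divide)
    moreover have "Re (\<phi> h) = (Re (\<phi> x) + Re (\<phi> y)) / 2"
      unfolding h_def using x y by (subst smult[OF real_scalar]) (auto simp: t_def add)
    ultimately have "(hnorm H (x \<ominus> y))\<^sup>2 = 2 * J x + 2 * J y - 4 * J h"
      using x y by (simp add: J_def norm_sq_diff field_simps)
    then show ?thesis using m_le[OF h] by simp
  qed
  have "M.MCauchy s"
    unfolding M.MCauchy_def
  proof (intro conjI allI impI)
    show "range s \<subseteq> carrier H" using s by auto
    fix e :: real assume e: "e > 0"
    then obtain N where N: "inverse (real (Suc N)) < e\<^sup>2 / 4"
      using reals_Archimedean[of "e\<^sup>2 / 4"] by auto
    have "hdist H (s n) (s n') < e" if "N \<le> n" "N \<le> n'" for n n'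
    proof -
      have "inverse (real (Suc k)) \<le> inverse (real (Suc N))" if "N \<le> k" for k
        using that by (intro le_imp_inverse_le) auto
      then have small: "J (s k) - m < e\<^sup>2 / 4" if "N \<le> k" for k
        using Js[of k] N that by (smt (verit))
      then have "(hnorm H (s n \<ominus> s n'))\<^sup>2 < e\<^sup>2"
        using near[OF s s, of n n'] small[OF that(1)] small[OF that(2)] by argo
      then have "hnorm H (s n \<ominus> s n') < e" using e by (simp add: power2_less_imp_less)
      then show ?thesis using s by (simp add: hdist_def)
    qed
    then show "\<exists>N. \<forall>n n'. N \<le> n \<longrightarrow> N \<le> n' \<longrightarrow> hdist H (s n) (s n') < e" by blast
  qed
  then obtain x where lim: "limitin M.mtopology s x sequentially"
    using complete unfolding M.mcomplete_def by blast
  then have x: "x \<in> carrier H" by (simp add: M.limitin_metric)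
  have dist: "hdist H (s n) x = hnorm H (s n \<ominus> x)" for n using s x by (simp add: hdist_def)
  have to0: "(\<lambda>n. hnorm H (s n \<ominus> x)) \<longlonglongrightarrow> 0"
  proof (rule tendstoI)
    fix e :: real assume "e > 0"
    then have "\<forall>\<^sub>F n in sequentially. s n \<in> carrier H \<and> hdist H (s n) x < e"
      using lim by (simp add: M.limitin_metric)
    then show "\<forall>\<^sub>F n in sequentially. dist (hnorm H (s n \<ominus> x)) 0 < e"
      by (rule eventually_mono) (use s x in \<open>simp add: dist hnorm_nonneg diff_closed\<close>)
  qed
  \<comment> \<open>Semicontinuity is enough: expanding \<open>J (s n)\<close> around the limit \<open>x\<close> bounds \<open>J x\<close> from
    above without control on the norms of the sequence.\<close>
  have Jx: "J x \<le> m"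
  proof (rule LIMSEQ_le_const)
    show "(\<lambda>n. m + inverse (real (Suc n)) + 2 * (hnorm H x + C) * hnorm H (s n \<ominus> x)) \<longlonglongrightarrow> m"
      using tendsto_add[OF tendsto_add[OF tendsto_const LIMSEQ_inverse_real_of_nat]
        tendsto_mult_left[OF to0]] by force
    have "J x \<le> m + inverse (real (Suc n)) + 2 * (hnorm H x + C) * hnorm H (s n \<ominus> x)" for n
    proof -
      define d where "d = s n \<ominus> x"
      have d: "d \<in> carrier H" using s x by (simp add: d_def diff_closed)
      have "J (s n) = J x + 2 * (Re (ip H x d) - Re (\<phi> d)) + (hnorm H d)\<^sup>2"
        using J_add[OF x d] add_diff_same[OF x s] by (simp add: d_def)
      moreover have "\<bar>Re (ip H x d)\<bar> \<le> hnorm H x * hnorm H d"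
        using cauchy_schwarz[OF x d] abs_Re_le_cmod[of "ip H x d"] by linarith
      ultimately have "J x \<le> m + inverse (real (Suc n)) + 2 * (hnorm H x * hnorm H d) + 2 * (C * hnorm H d)"
        using Js[of n] Re_bound[OF d] zero_le_power2[of "hnorm H d"] by argo
      then show ?thesis by (simp add: d_def algebra_simps)
    qed
    then show "\<exists>N. \<forall>n\<ge>N. J x \<le> m + inverse (real (Suc n)) + 2 * (hnorm H x + C) * hnorm H (s n \<ominus> x)"
      by blast
  qed
  have Re_eq: "Re (\<phi> z) = Re (ip H z x)" if z: "z \<in> carrier H" for z
  proof -
    have "Re (ip H x z) - Re (\<phi> z) = 0"
    proof (rule linear_term_vanishes[of "(hnorm H z)\<^sup>2"])
      fix t :: real
      define d where "d = complex_of_real t \<odot>\<^bsub>H\<^esub> z"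
      have d: "d \<in> carrier H" using z by (simp add: d_def smult_clos real_scalar)
      have "0 \<le> J (x \<oplus> d) - J x" using Jx m_le[of "x \<oplus> d"] x d by simp
      also have "\<dots> = 2 * t * (Re (ip H x z) - Re (\<phi> z)) + t\<^sup>2 * (hnorm H z)\<^sup>2"
        unfolding J_add[OF x d] using x z
        by (simp add: d_def ip_smult_right smult hnorm_smult real_scalar power_mult_distrib
            algebra_simps)
      finally show "0 \<le> 2 * t * (Re (ip H x z) - Re (\<phi> z)) + t\<^sup>2 * (hnorm H z)\<^sup>2" .
    qed simp
    then show ?thesis using ip_commute[OF z x] by simp
  qed
  have "\<phi> z = ip H z x" if z: "z \<in> carrier H" for z
  proof (cases "\<i> \<in> K")
    case True
    \<comment> \<open>The real part at \<open>\<i> z\<close> is minus the imaginary part at \<open>z\<close>.\<close>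
    have "Im (\<phi> z) = Im (ip H z x)"
      using Re_eq[OF smult_clos[OF True z]] smult[OF True z] ip_smult_left[OF True z x] by simp
    then show ?thesis using Re_eq[OF z] by (simp add: complex_eq_iff)
  next
    case False
    then have "K = \<real>" using scalars by auto
    then show ?thesis
      using Re_eq[OF z] closed[OF z] ip_closed[OF z x] by (simp add: complex_eq_iff complex_is_Real_iff)
  qed
  with x show ?thesis by blast
qed

lemma bounded_opsD:
  assumes "A \<in> bounded_ops K G H"
  shows "x \<in> carrier G \<Longrightarrow> A x \<in> carrier H"
    and "\<lbrakk>x \<in> carrier G; y \<in> carrier G\<rbrakk> \<Longrightarrow> A (x \<oplus>\<^bsub>G\<^esub> y) = A x \<oplus>\<^bsub>H\<^esub> A y"
    and "\<lbrakk>c \<in> K; x \<in> carrier G\<rbrakk> \<Longrightarrow> A (c \<odot>\<^bsub>G\<^esub> x) = c \<odot>\<^bsub>H\<^esub> A x"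
    and "\<exists>C. \<forall>x\<in>carrier G. hnorm H (A x) \<le> C * hnorm G x"
  using assms by (auto simp: bounded_ops_def)

lemma hadjoint:
  assumes G: "hilbert_space K G" and H: "inner_product_space K H"
    and A: "A \<in> bounded_ops K G H" and y: "y \<in> carrier H"
  shows "hadjoint G H A y \<in> carrier G"
    and "z \<in> carrier G \<Longrightarrow> ip H (A z) y = ip G z (hadjoint G H A y)"
proof -
  interpret G: hilbert_space K G by (rule G)
  interpret H: inner_product_space K H by (rule H)
  note A' = bounded_opsD[OF A]
  obtain C where C: "\<And>x. x \<in> carrier G \<Longrightarrow> hnorm H (A x) \<le> C * hnorm G x"
    using A'(4) by blast
  have "\<exists>x\<in>carrier G. \<forall>z\<in>carrier G. ip H (A z) y = ip G z x"
  proof (rule G.riesz_representation)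
    show "ip H (A z) y \<in> K" if "z \<in> carrier G" for z
      using that y A'(1) by (simp add: H.ip_closed)
    show "ip H (A (u \<oplus>\<^bsub>G\<^esub> v)) y = ip H (A u) y + ip H (A v) y"
      if "u \<in> carrier G" "v \<in> carrier G" for u v
      using that y A' by (simp add: H.ip_add_left)
    show "ip H (A (c \<odot>\<^bsub>G\<^esub> u)) y = c * ip H (A u) y" if "c \<in> K" "u \<in> carrier G" for c u
      using that y A' by (simp add: H.ip_smult_left)
    show "cmod (ip H (A u) y) \<le> (C * hnorm H y) * hnorm G u" if "u \<in> carrier G" for u
      using order_trans[OF H.cauchy_schwarz[OF A'(1)[OF that] y]
        mult_right_mono[OF C[OF that] H.hnorm_nonneg[OF y]]] by (simp add: mult_ac)
  qed
  then obtain x where x: "x \<in> carrier G" "\<forall>z\<in>carrier G. ip H (A z) y = ip G z x"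
    by blast
  have "\<exists>!x. x \<in> carrier G \<and> (\<forall>z\<in>carrier G. ip H (A z) y = ip G z x)"
  proof (rule ex1I)
    show "x \<in> carrier G \<and> (\<forall>z\<in>carrier G. ip H (A z) y = ip G z x)" using x by blast
    show "x' = x" if "x' \<in> carrier G \<and> (\<forall>z\<in>carrier G. ip H (A z) y = ip G z x')" for x'
      by (rule G.eq_if_ip_eq) (use that x in auto)
  qed
  from theI'[OF this] have "hadjoint G H A y \<in> carrier G \<and>
      (\<forall>z\<in>carrier G. ip H (A z) y = ip G z (hadjoint G H A y))"
    unfolding hadjoint_def .
  then show "hadjoint G H A y \<in> carrier G"
    and "z \<in> carrier G \<Longrightarrow> ip H (A z) y = ip G z (hadjoint G H A y)"
    by simp_all
qed

section \<open>Convergence of weakly dominated series\<close>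

text \<open>Stated with a domination of the terms rather than for products, so that it applies to families
  of inner products in varying Hilbert spaces.\<close>

lemma infsum_cauchy_schwarz:
  fixes c :: "'i \<Rightarrow> complex" and a b :: "'i \<Rightarrow> real"
  assumes a: "(\<lambda>i. (a i)\<^sup>2) summable_on I" and b: "(\<lambda>i. (b i)\<^sup>2) summable_on I"
    and c: "\<And>i. i \<in> I \<Longrightarrow> cmod (c i) \<le> \<bar>a i\<bar> * \<bar>b i\<bar>"
  shows "c summable_on I"
    and "cmod (infsum c I) \<le> sqrt (\<Sum>\<^sub>\<infinity>i\<in>I. (a i)\<^sup>2) * sqrt (\<Sum>\<^sub>\<infinity>i\<in>I. (b i)\<^sup>2)"
proof -
  let ?B = "sqrt (\<Sum>\<^sub>\<infinity>i\<in>I. (a i)\<^sup>2) * sqrt (\<Sum>\<^sub>\<infinity>i\<in>I. (b i)\<^sup>2)"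
  have fin: "(\<Sum>i\<in>F. cmod (c i)) \<le> ?B" if F: "finite F" "F \<subseteq> I" for F
  proof -
    have "(\<Sum>i\<in>F. cmod (c i)) \<le> (\<Sum>i\<in>F. \<bar>a i\<bar> * \<bar>b i\<bar>)"
      using F c by (intro sum_mono) auto
    also have "\<dots> \<le> L2_set a F * L2_set b F" by (rule L2_set_mult_ineq)
    also have "\<dots> \<le> ?B"
      unfolding L2_set_def using F a b
      by (intro mult_mono real_sqrt_le_mono finite_sum_le_infsum real_sqrt_ge_zero infsum_nonneg sum_nonneg) auto
    finally show ?thesis .
  qed
  have abs: "(\<lambda>i. cmod (c i)) summable_on I"
    using fin by (intro nonneg_bdd_above_summable_on) (auto intro!: bdd_aboveI)
  then show "c summable_on I" by (rule abs_summable_summable)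
  have "cmod (infsum c I) \<le> (\<Sum>\<^sub>\<infinity>i\<in>I. cmod (c i))" using abs by (rule norm_infsum_bound)
  also have "\<dots> \<le> ?B" using abs fin by (rule infsum_le_finite_sums)
  finally show "cmod (infsum c I) \<le> ?B" .
qed

text \<open>The partial sums are compared with the vector that represents $z \mapsto \sum_i \langle z, u_i
  \rangle$. Since the domination involves \<open>z\<close> only through a family whose square sum is at most $B
  \|z\|^2$, the remainder after \<open>F\<close> has norm at most $\sqrt B$ times the square root of
  $\sum_{i \notin F} a_i^2$, which tends to 0. In the application \<open>a\<close> comes from \<open>\<Lambda>\<close> and \<open>b\<close> from
  \<open>\<Gamma>\<close>.\<close>

lemma (in hilbert_space) hsum_weak:
  fixes a :: "'i \<Rightarrow> real" and b :: "'a \<Rightarrow> 'i \<Rightarrow> real"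
  assumes u: "\<And>i. i \<in> I \<Longrightarrow> u i \<in> carrier H"
    and a: "(\<lambda>i. (a i)\<^sup>2) summable_on I"
    and b: "\<And>z. z \<in> carrier H \<Longrightarrow> (\<lambda>i. (b z i)\<^sup>2) summable_on I"
    and B: "0 \<le> B"
    and bB: "\<And>z. z \<in> carrier H \<Longrightarrow> (\<Sum>\<^sub>\<infinity>i\<in>I. (b z i)\<^sup>2) \<le> B * (hnorm H z)\<^sup>2"
    and dom: "\<And>z i. \<lbrakk>z \<in> carrier H; i \<in> I\<rbrakk> \<Longrightarrow> cmod (ip H z (u i)) \<le> \<bar>a i\<bar> * \<bar>b z i\<bar>"
  shows "hsum H u I \<in> carrier H"
    and "z \<in> carrier H \<Longrightarrow> ip H z (hsum H u I) = (\<Sum>\<^sub>\<infinity>i\<in>I. ip H z (u i))"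
proof -
  interpret M: Metric_space "carrier H" "hdist H" by (rule Metric_space_hdist)
  have summ: "(\<lambda>i. ip H z (u i)) summable_on I" if "z \<in> carrier H" for z
    by (rule infsum_cauchy_schwarz(1)[OF a b[OF that] dom[OF that]])
  have tail: "cmod (\<Sum>\<^sub>\<infinity>i\<in>I - F. ip H z (u i)) \<le>
      sqrt (\<Sum>\<^sub>\<infinity>i\<in>I - F. (a i)\<^sup>2) * (sqrt B * hnorm H z)"
    if z: "z \<in> carrier H" and F: "finite F" "F \<subseteq> I" for z F
  proof -
    have "cmod (\<Sum>\<^sub>\<infinity>i\<in>I - F. ip H z (u i)) \<le>
        sqrt (\<Sum>\<^sub>\<infinity>i\<in>I - F. (a i)\<^sup>2) * sqrt (\<Sum>\<^sub>\<infinity>i\<in>I - F. (b z i)\<^sup>2)"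
      by (rule infsum_cauchy_schwarz(2))
        (use a b[OF z] dom[OF z] F in \<open>auto intro: summable_on_cofin_subset\<close>)
    also have "(\<Sum>\<^sub>\<infinity>i\<in>I - F. (b z i)\<^sup>2) \<le> (\<Sum>\<^sub>\<infinity>i\<in>I. (b z i)\<^sup>2)"
      using b[OF z] F by (intro infsum_mono_neutral) (auto intro: summable_on_cofin_subset)
    also have "\<dots> \<le> B * (hnorm H z)\<^sup>2" by (rule bB[OF z])
    also have "sqrt \<dots> = sqrt B * hnorm H z" using hnorm_nonneg[OF z] by (simp add: real_sqrt_mult)
    finally show ?thesis by (simp add: mult_left_mono infsum_nonneg)
  qed
  have "\<exists>s\<in>carrier H. \<forall>z\<in>carrier H. (\<Sum>\<^sub>\<infinity>i\<in>I. ip H z (u i)) = ip H z s"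
  proof (rule riesz_representation)
    \<comment> \<open>Over the reals, the sum of real terms is fixed by conjugation, hence real.\<close>
    show "(\<Sum>\<^sub>\<infinity>i\<in>I. ip H z (u i)) \<in> K" if z: "z \<in> carrier H" for z
    proof (cases "K = UNIV")
      case False
      then have K: "K = \<real>" using scalars by auto
      have "cnj (\<Sum>\<^sub>\<infinity>i\<in>I. ip H z (u i)) = (\<Sum>\<^sub>\<infinity>i\<in>I. ip H z (u i))"
        unfolding infsum_cnj[symmetric]
        using ip_closed[OF z u] by (intro infsum_cong) (simp add: K Reals_cnj_iff)
      then show ?thesis by (simp add: K Reals_cnj_iff)
    qed simp
    show "(\<Sum>\<^sub>\<infinity>i\<in>I. ip H (x \<oplus> y) (u i)) = (\<Sum>\<^sub>\<infinity>i\<in>I. ip H x (u i)) + (\<Sum>\<^sub>\<infinity>i\<in>I. ip H y (u i))"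
      if "x \<in> carrier H" "y \<in> carrier H" for x y
      using that u by (simp add: ip_add_left infsum_add[symmetric] summ cong: infsum_cong)
    show "(\<Sum>\<^sub>\<infinity>i\<in>I. ip H (c \<odot>\<^bsub>H\<^esub> x) (u i)) = c * (\<Sum>\<^sub>\<infinity>i\<in>I. ip H x (u i))"
      if "c \<in> K" "x \<in> carrier H" for c x
      using that u by (simp add: ip_smult_left infsum_cmult_right' cong: infsum_cong)
    show "cmod (\<Sum>\<^sub>\<infinity>i\<in>I. ip H x (u i)) \<le> (sqrt (\<Sum>\<^sub>\<infinity>i\<in>I. (a i)\<^sup>2) * sqrt B) * hnorm H x"
      if "x \<in> carrier H" for x
      using tail[OF that, of "{}"] by (simp add: mult.assoc)
  qed
  then obtain s where s: "s \<in> carrier H"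
    and weak: "\<And>z. z \<in> carrier H \<Longrightarrow> (\<Sum>\<^sub>\<infinity>i\<in>I. ip H z (u i)) = ip H z s" by blast
  \<comment> \<open>Testing the remainder against itself turns the weak tail estimate into a norm estimate.\<close>
  have rem: "hdist H (\<Oplus>i\<in>F. u i) s \<le> sqrt B * sqrt (\<Sum>\<^sub>\<infinity>i\<in>I - F. (a i)\<^sup>2)"
    and sumF: "(\<Oplus>i\<in>F. u i) \<in> carrier H"
    if F: "finite F" "F \<subseteq> I" for F
  proof -
    have uF: "u \<in> F \<rightarrow> carrier H" using u F by auto
    then show sF: "(\<Oplus>i\<in>F. u i) \<in> carrier H" by (rule finsum_closed)
    define w where "w = s \<ominus> (\<Oplus>i\<in>F. u i)"
    have w: "w \<in> carrier H" using s sF by (simp add: w_def diff_closed)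
    have "ip H w w = ip H w s - (\<Sum>i\<in>F. ip H w (u i))"
      using ip_diff_right[OF s sF w] ip_finsum_right[OF w F(1) uF] by (simp add: w_def)
    also have "\<dots> = (\<Sum>\<^sub>\<infinity>i\<in>I - F. ip H w (u i))"
      using F summ[OF w] weak[OF w] by (simp add: infsum_Diff)
    finally have "(hnorm H w)\<^sup>2 = cmod (\<Sum>\<^sub>\<infinity>i\<in>I - F. ip H w (u i))"
      using ip_self[OF w] by (metis norm_of_real abs_power2)
    then have "hnorm H w * hnorm H w \<le> (sqrt B * sqrt (\<Sum>\<^sub>\<infinity>i\<in>I - F. (a i)\<^sup>2)) * hnorm H w"
      using tail[OF w F] by (simp add: power2_eq_square mult_ac)
    moreover have "0 \<le> sqrt B * sqrt (\<Sum>\<^sub>\<infinity>i\<in>I - F. (a i)\<^sup>2)"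
      using B by (simp add: infsum_nonneg)
    ultimately have "hnorm H w \<le> sqrt B * sqrt (\<Sum>\<^sub>\<infinity>i\<in>I - F. (a i)\<^sup>2)"
      using hnorm_nonneg[OF w] by (cases "hnorm H w = 0") (auto simp: mult_le_cancel_right)
    then show "hdist H (\<Oplus>i\<in>F. u i) s \<le> sqrt B * sqrt (\<Sum>\<^sub>\<infinity>i\<in>I - F. (a i)\<^sup>2)"
      using M.commute[of s "\<Oplus>i\<in>F. u i"] s sF by (simp add: hdist_def w_def)
  qed
  have "((\<lambda>F. \<Sum>i\<in>F. (a i)\<^sup>2) \<longlongrightarrow> (\<Sum>\<^sub>\<infinity>i\<in>I. (a i)\<^sup>2)) (finite_subsets_at_top I)"
    using a by (rule infsum_tendsto)
  then have "((\<lambda>F. sqrt B * sqrt ((\<Sum>\<^sub>\<infinity>i\<in>I. (a i)\<^sup>2) - (\<Sum>i\<in>F. (a i)\<^sup>2))) \<longlongrightarrow>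
      sqrt B * sqrt ((\<Sum>\<^sub>\<infinity>i\<in>I. (a i)\<^sup>2) - (\<Sum>\<^sub>\<infinity>i\<in>I. (a i)\<^sup>2))) (finite_subsets_at_top I)"
    by (intro tendsto_intros)
  then have to0: "((\<lambda>F. sqrt B * sqrt ((\<Sum>\<^sub>\<infinity>i\<in>I. (a i)\<^sup>2) - (\<Sum>i\<in>F. (a i)\<^sup>2))) \<longlongrightarrow> 0)
      (finite_subsets_at_top I)" by simp
  have lim: "limitin M.mtopology (\<lambda>F. \<Oplus>i\<in>F. u i) s (finite_subsets_at_top I)"
    unfolding M.limitin_metric
  proof (intro conjI allI impI s)
    fix e :: real assume "e > 0"
    with order_tendstoD(2)[OF to0]
    have "\<forall>\<^sub>F F in finite_subsets_at_top I. sqrt B * sqrt ((\<Sum>\<^sub>\<infinity>i\<in>I. (a i)\<^sup>2) - (\<Sum>i\<in>F. (a i)\<^sup>2)) < e"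
      by blast
    moreover have "\<forall>\<^sub>F F in finite_subsets_at_top I. finite F \<and> F \<subseteq> I"
      by (simp add: eventually_finite_subsets_at_top_weakI)
    ultimately show "\<forall>\<^sub>F F in finite_subsets_at_top I.
        (\<Oplus>i\<in>F. u i) \<in> carrier H \<and> hdist H (\<Oplus>i\<in>F. u i) s < e"
      by eventually_elim (use rem sumF a in \<open>force simp: infsum_Diff\<close>)
  qed
  have "hsum H u I = s"
    unfolding hsum_def
  proof (rule the_equality)
    show "limitin M.mtopology (\<lambda>F. \<Oplus>i\<in>F. u i) s (finite_subsets_at_top I)" by (rule lim)
    show "t = s" if "limitin M.mtopology (\<lambda>F. \<Oplus>i\<in>F. u i) t (finite_subsets_at_top I)" for t
      using M.limitin_metric_unique[OF that lim] by simp
  qed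
  then show "hsum H u I \<in> carrier H"
    and "z \<in> carrier H \<Longrightarrow> ip H z (hsum H u I) = (\<Sum>\<^sub>\<infinity>i\<in>I. ip H z (u i))"
    using s weak by auto
qed


section \<open>Operators close to the identity\<close>

context inner_product_space begin

lemma hnorm_le_add_diff:
  "\<lbrakk>x \<in> carrier H; y \<in> carrier H\<rbrakk> \<Longrightarrow> hnorm H x \<le> hnorm H y + hnorm H (x \<ominus> y)"
  using hnorm_triangle[of y "x \<ominus> y"] add_diff_same[of y x] diff_closed[of x y] by simp

lemma hnorm_diff_commute:
  "\<lbrakk>x \<in> carrier H; y \<in> carrier H\<rbrakk> \<Longrightarrow> hnorm H (x \<ominus> y) = hnorm H (y \<ominus> x)"
  using Metric_space.commute[OF Metric_space_hdist, of x y] by (simp add: hdist_def)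

end

text \<open>The contraction principle replaces the Neumann series. The vector identities that linearity
  provides are checked by pairing with an arbitrary vector, where they become identities of complex
  numbers.\<close>

lemma (in hilbert_space) near_identity_in_GL:
  assumes S: "\<And>x. x \<in> carrier H \<Longrightarrow> S x \<in> carrier H"
    and add: "\<And>x y. \<lbrakk>x \<in> carrier H; y \<in> carrier H\<rbrakk> \<Longrightarrow> S (x \<oplus> y) = S x \<oplus> S y"
    and smult: "\<And>c x. \<lbrakk>c \<in> K; x \<in> carrier H\<rbrakk> \<Longrightarrow> S (c \<odot>\<^bsub>H\<^esub> x) = c \<odot>\<^bsub>H\<^esub> S x"
    and "\<epsilon> < 1"
    and near: "\<And>x. x \<in> carrier H \<Longrightarrow> hnorm H (x \<ominus> S x) \<le> \<epsilon> * hnorm H x"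
  shows "S \<in> GL K H"
proof -
  interpret M: Metric_space "carrier H" "hdist H" by (rule Metric_space_hdist)
  have upper: "hnorm H (S x) \<le> (1 + \<epsilon>) * hnorm H x" if x: "x \<in> carrier H" for x
    using hnorm_le_add_diff[OF S[OF x] x] hnorm_diff_commute[OF S[OF x] x] near[OF x]
    by (simp add: distrib_right)
  have lower: "(1 - \<epsilon>) * hnorm H x \<le> hnorm H (S x)" if x: "x \<in> carrier H" for x
    using hnorm_le_add_diff[OF x S[OF x]] near[OF x] by (simp add: left_diff_distrib)
  have S_diff: "ip H z (S (x \<ominus> y)) = ip H z (S x) - ip H z (S y)"
    if "x \<in> carrier H" "y \<in> carrier H" "z \<in> carrier H" for x y z
    using that add[of y "x \<ominus> y"] add_diff_same[of y x] ip_add_right[of "S y" "S (x \<ominus> y)" z]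
    by (simp add: S diff_closed)
  have inj: "x = y" if x: "x \<in> carrier H" and y: "y \<in> carrier H" and eq: "S x = S y" for x y
  proof -
    have d: "x \<ominus> y \<in> carrier H" using x y by (rule diff_closed)
    have "ip H (S (x \<ominus> y)) (S (x \<ominus> y)) = 0"
      using S_diff[OF x y S[OF d]] eq by simp
    then have "hnorm H (S (x \<ominus> y)) = 0" by (simp add: hnorm_def)
    then have "(1 - \<epsilon>) * hnorm H (x \<ominus> y) \<le> 0" using lower[OF d] by simp
    then have "hnorm H (x \<ominus> y) = 0"
      using \<open>\<epsilon> < 1\<close> hnorm_nonneg[OF d] by (simp add: mult_le_0_iff)
    then have "x \<ominus> y = \<zero>" using d by (simp add: hnorm_zero_iff)
    then show ?thesis using add_diff_same[OF y x] y by simp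
  qed
  have surj: "\<exists>x\<in>carrier H. S x = g" if g: "g \<in> carrier H" for g
  proof -
    define P where "P x = g \<oplus> (x \<ominus> S x)" for x
    have P: "P x \<in> carrier H" if "x \<in> carrier H" for x
      using that g by (simp add: P_def S diff_closed)
    have P_diff: "P x \<ominus> P y = (x \<ominus> y) \<ominus> S (x \<ominus> y)"
      if "x \<in> carrier H" "y \<in> carrier H" for x y
    proof (rule eq_if_ip_eq)
      show "ip H z (P x \<ominus> P y) = ip H z (x \<ominus> y \<ominus> S (x \<ominus> y))" if z: "z \<in> carrier H" for z
        using \<open>x \<in> carrier H\<close> \<open>y \<in> carrier H\<close> z g P
        by (simp add: ip_diff_right S_diff S diff_closed) (simp add: P_def ip_add_right ip_diff_right S diff_closed)
    qed (use that P S in \<open>simp_all add: diff_closed\<close>)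
    have contr: "hdist H (P x) (P y) \<le> \<epsilon> * hdist H x y"
      if "x \<in> carrier H" "y \<in> carrier H" for x y
      using that near[of "x \<ominus> y"] by (simp add: hdist_def P P_diff diff_closed)
    have ne: "carrier H \<noteq> {}" using g by auto
    have im: "P \<in> carrier H \<rightarrow> carrier H" using P by auto
    obtain x where x: "x \<in> carrier H" and fp: "P x = x"
      using M.Banach_fixedpoint_thm[OF complete ne im \<open>\<epsilon> < 1\<close> contr] by metis
    have "S x = g"
    proof (rule eq_if_ip_eq[OF S[OF x] g])
      fix z assume z: "z \<in> carrier H"
      have "ip H z x = ip H z g + (ip H z x - ip H z (S x))"
        using x g z arg_cong[OF fp, of "ip H z"]
        by (simp add: P_def ip_add_right ip_diff_right S diff_closed)
      then show "ip H z (S x) = ip H z g" by simp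
    qed
    with x show ?thesis by blast
  qed
  then obtain R where R: "\<And>g. g \<in> carrier H \<Longrightarrow> R g \<in> carrier H"
    and SR: "\<And>g. g \<in> carrier H \<Longrightarrow> S (R g) = g" by metis
  have S_op: "S \<in> bounded_ops K H H"
    unfolding bounded_ops_def mem_Collect_eq
    using S add smult upper by (intro conjI ballI exI[of _ "1 + \<epsilon>"]) auto
  have "hnorm H (R g) \<le> 1 / (1 - \<epsilon>) * hnorm H g" if "g \<in> carrier H" for g
    using lower[OF R[OF that]] SR[OF that] \<open>\<epsilon> < 1\<close> by (simp add: field_simps)
  moreover have "R (x \<oplus> y) = R x \<oplus> R y" if "x \<in> carrier H" "y \<in> carrier H" for x y
    by (rule inj) (use that in \<open>simp_all add: R SR add\<close>)
  moreover have "R (c \<odot>\<^bsub>H\<^esub> x) = c \<odot>\<^bsub>H\<^esub> R x" if "c \<in> K" "x \<in> carrier H" for c x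
    by (rule inj) (use that in \<open>simp_all add: R SR smult smult_clos\<close>)
  ultimately have R_op: "R \<in> bounded_ops K H H"
    unfolding bounded_ops_def mem_Collect_eq
    using R by (intro conjI ballI exI[of _ "1 / (1 - \<epsilon>)"]) auto
  have "R (S x) = x" if "x \<in> carrier H" for x
    by (rule inj) (use that in \<open>simp_all add: R SR S\<close>)
  then show ?thesis
    unfolding GL_def using S_op R_op SR by blast
qed

section \<open>The controlled frame operator\<close>

lemma GL_bounded: "T \<in> GL K H \<Longrightarrow> T \<in> bounded_ops K H H"
  by (simp add: GL_def)

lemma (in inner_product_space) g_upper_bound_mono:
  assumes "g_upper_bound H I E \<Lambda> B" "B \<le> B'"
  shows "g_upper_bound H I E \<Lambda> B'"
  using assms order_trans mult_right_mono[OF assms(2) zero_le_power2]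
  unfolding g_upper_bound_def by blast

text \<open>Bessel bounds can always be enlarged to positive ones, whereas a negative bound is conceivable
  when \<open>H\<close> is trivial; the lower frame bounds below divide by \<open>B\<close> and \<open>D\<close>.\<close>

locale controlled_bessel_pair = hilbert_space K H
  for K :: "complex set" and H :: "'a ip_module" (structure) +
  fixes I :: "int set" and E :: "int \<Rightarrow> 'b ip_module" and T U :: "'a \<Rightarrow> 'a"
    and \<Lambda> \<Gamma> :: "int \<Rightarrow> 'a \<Rightarrow> 'b" and B D :: real
  assumes E: "\<And>i. i \<in> I \<Longrightarrow> hilbert_space K (E i)"
    and T: "T \<in> bounded_ops K H H" and U: "U \<in> bounded_ops K H H"
    and \<Lambda>: "\<And>i. i \<in> I \<Longrightarrow> \<Lambda> i \<in> bounded_ops K H (E i)"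
    and \<Gamma>: "\<And>i. i \<in> I \<Longrightarrow> \<Gamma> i \<in> bounded_ops K H (E i)"
    and B: "g_upper_bound H I E (\<lambda>i. \<Lambda> i \<circ> T) B"
    and D: "g_upper_bound H I E (\<lambda>i. \<Gamma> i \<circ> U) D"
    and bounds_pos: "0 < B" "0 < D"
begin

abbreviation S :: "'a \<Rightarrow> 'a" where
  "S \<equiv> controlled_op H I E T \<Gamma> \<Lambda> U"

lemma E_ip: "i \<in> I \<Longrightarrow> inner_product_space K (E i)"
  using E by (simp add: hilbert_space_def)

lemma \<Lambda>T_closed: "\<lbrakk>i \<in> I; f \<in> carrier H\<rbrakk> \<Longrightarrow> \<Lambda> i (T f) \<in> carrier (E i)"
  using bounded_opsD(1)[OF \<Lambda>] bounded_opsD(1)[OF T] by blast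

lemma \<Gamma>U_closed: "\<lbrakk>i \<in> I; f \<in> carrier H\<rbrakk> \<Longrightarrow> \<Gamma> i (U f) \<in> carrier (E i)"
  using bounded_opsD(1)[OF \<Gamma>] bounded_opsD(1)[OF U] by blast

text \<open>All later facts about \<open>S\<close> are derived from its matrix coefficients, so that the adjoints and
  the limit in its definition do not have to be handled again.\<close>

lemma S_weak:
  assumes f: "f \<in> carrier H"
  shows "S f \<in> carrier H"
    and "z \<in> carrier H \<Longrightarrow> (\<lambda>i. ip (E i) (\<Gamma> i (U z)) (\<Lambda> i (T f))) summable_on I"
    and "z \<in> carrier H \<Longrightarrow> ip H z (S f) = (\<Sum>\<^sub>\<infinity>i\<in>I. ip (E i) (\<Gamma> i (U z)) (\<Lambda> i (T f)))"
    and "z \<in> carrier H \<Longrightarrow> cmod (ip H z (S f)) \<le>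
           sqrt (\<Sum>\<^sub>\<infinity>i\<in>I. (hnorm (E i) (\<Lambda> i (T f)))\<^sup>2) *
           sqrt (\<Sum>\<^sub>\<infinity>i\<in>I. (hnorm (E i) (\<Gamma> i (U z)))\<^sup>2)"
proof -
  define u where "u i = hadjoint H H U (hadjoint H (E i) (\<Gamma> i) (\<Lambda> i (T f)))" for i
  define a where "a i = hnorm (E i) (\<Lambda> i (T f))" for i
  define b where "b z i = hnorm (E i) (\<Gamma> i (U z))" for z i
  let ?S = "S f"
  have H: "hilbert_space K H" by (rule hilbert_space_axioms)
  note \<Lambda>Tf = \<Lambda>T_closed[OF _ f]
  have adj: "hadjoint H (E i) (\<Gamma> i) (\<Lambda> i (T f)) \<in> carrier H" if "i \<in> I" for i
    using hadjoint(1)[OF H E_ip \<Gamma> \<Lambda>Tf, OF that that that] .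
  have u: "u i \<in> carrier H" if "i \<in> I" for i
    unfolding u_def by (rule hadjoint(1)[OF H inner_product_space_axioms U adj[OF that]])
  have ip_u: "ip H z (u i) = ip (E i) (\<Gamma> i (U z)) (\<Lambda> i (T f))" if i: "i \<in> I" and z: "z \<in> carrier H" for i z
    unfolding u_def
    using hadjoint(2)[OF H inner_product_space_axioms U adj[OF i] z]
      hadjoint(2)[OF H E_ip[OF i] \<Gamma>[OF i] \<Lambda>Tf[OF i] bounded_opsD(1)[OF U z]] by simp
  have dom: "cmod (ip H z (u i)) \<le> \<bar>a i\<bar> * \<bar>b z i\<bar>" if z: "z \<in> carrier H" and i: "i \<in> I" for z i
    using inner_product_space.cauchy_schwarz[OF E_ip[OF i] \<Gamma>U_closed[OF i z] \<Lambda>Tf[OF i]]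
      inner_product_space.hnorm_nonneg[OF E_ip[OF i] \<Lambda>Tf[OF i]]
      inner_product_space.hnorm_nonneg[OF E_ip[OF i] \<Gamma>U_closed[OF i z]]
    by (simp add: ip_u[OF i z] a_def b_def mult.commute)
  have a: "(\<lambda>i. (a i)\<^sup>2) summable_on I"
    using B f by (simp add: g_upper_bound_def a_def)
  have b: "(\<lambda>i. (b z i)\<^sup>2) summable_on I" if "z \<in> carrier H" for z
    using D that by (simp add: g_upper_bound_def b_def)
  have bD: "(\<Sum>\<^sub>\<infinity>i\<in>I. (b z i)\<^sup>2) \<le> D * (hnorm H z)\<^sup>2" if "z \<in> carrier H" for z
    using D that by (simp add: g_upper_bound_def b_def)
  have S_eq: "?S = hsum H u I" by (simp add: controlled_op_def u_def[abs_def])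
  note conv = hsum_weak[where u = u and a = a and b = b and B = D and I = I]
  show "?S \<in> carrier H"
    unfolding S_eq by (rule conv(1)) (fact u a b less_imp_le[OF bounds_pos(2)] bD dom)+
  have eq: "ip H z ?S = (\<Sum>\<^sub>\<infinity>i\<in>I. ip H z (u i))" if z: "z \<in> carrier H" for z
    unfolding S_eq by (rule conv(2)) (fact z u a b less_imp_le[OF bounds_pos(2)] bD dom)+
  note bound = infsum_cauchy_schwarz[where c = "\<lambda>i. ip H z (u i)" and a = a and b = "b z" and I = I for z]
  have summ: "(\<lambda>i. ip H z (u i)) summable_on I"
    and norm: "cmod (\<Sum>\<^sub>\<infinity>i\<in>I. ip H z (u i)) \<le> sqrt (\<Sum>\<^sub>\<infinity>i\<in>I. (a i)\<^sup>2) * sqrt (\<Sum>\<^sub>\<infinity>i\<in>I. (b z i)\<^sup>2)"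
    if z: "z \<in> carrier H" for z
    by (rule bound; fact a b[OF z] dom[OF z])+
  show "(\<lambda>i. ip (E i) (\<Gamma> i (U z)) (\<Lambda> i (T f))) summable_on I" if z: "z \<in> carrier H"
    using summ[OF z] summable_on_cong[of I "\<lambda>i. ip H z (u i)"] ip_u[OF _ z] by simp
  show "ip H z ?S = (\<Sum>\<^sub>\<infinity>i\<in>I. ip (E i) (\<Gamma> i (U z)) (\<Lambda> i (T f)))" if z: "z \<in> carrier H"
    unfolding eq[OF z] by (rule infsum_cong) (rule ip_u[OF _ z])
  show "cmod (ip H z ?S) \<le> sqrt (\<Sum>\<^sub>\<infinity>i\<in>I. (hnorm (E i) (\<Lambda> i (T f)))\<^sup>2) *
           sqrt (\<Sum>\<^sub>\<infinity>i\<in>I. (hnorm (E i) (\<Gamma> i (U z)))\<^sup>2)" if z: "z \<in> carrier H"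
    using norm[OF z] unfolding eq[OF z] a_def b_def .
qed

lemma S_linear:
  shows "\<lbrakk>x \<in> carrier H; y \<in> carrier H\<rbrakk> \<Longrightarrow> S (x \<oplus> y) = S x \<oplus> S y"
    and "\<lbrakk>c \<in> K; x \<in> carrier H\<rbrakk> \<Longrightarrow> S (c \<odot>\<^bsub>H\<^esub> x) = c \<odot>\<^bsub>H\<^esub> S x"
proof -
  show "S (x \<oplus> y) = S x \<oplus> S y" if x: "x \<in> carrier H" and y: "y \<in> carrier H"
  proof (rule eq_if_ip_eq)
    fix z assume z: "z \<in> carrier H"
    have "ip (E i) (\<Gamma> i (U z)) (\<Lambda> i (T (x \<oplus> y))) =
        ip (E i) (\<Gamma> i (U z)) (\<Lambda> i (T x)) + ip (E i) (\<Gamma> i (U z)) (\<Lambda> i (T y))" if i: "i \<in> I" for i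
      using inner_product_space.ip_add_right[OF E_ip[OF i] \<Lambda>T_closed[OF i x] \<Lambda>T_closed[OF i y] \<Gamma>U_closed[OF i z]]
        bounded_opsD(2)[OF T x y]
        bounded_opsD(2)[OF \<Lambda>[OF i] bounded_opsD(1)[OF T x] bounded_opsD(1)[OF T y]] by simp
    then have "ip H z (S (x \<oplus> y)) = ip H z (S x) + ip H z (S y)"
      using x y z by (simp add: S_weak(3) infsum_add[OF S_weak(2) S_weak(2), symmetric] cong: infsum_cong)
    then show "ip H z (S (x \<oplus> y)) = ip H z (S x \<oplus> S y)"
      using x y z by (simp add: ip_add_right S_weak(1))
  qed (use x y S_weak(1) in auto)
  show "S (c \<odot>\<^bsub>H\<^esub> x) = c \<odot>\<^bsub>H\<^esub> S x" if c: "c \<in> K" and x: "x \<in> carrier H"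
  proof (rule eq_if_ip_eq)
    fix z assume z: "z \<in> carrier H"
    have "ip (E i) (\<Gamma> i (U z)) (\<Lambda> i (T (c \<odot>\<^bsub>H\<^esub> x))) =
        cnj c * ip (E i) (\<Gamma> i (U z)) (\<Lambda> i (T x))" if i: "i \<in> I" for i
      using inner_product_space.ip_smult_right[OF E_ip[OF i] c \<Lambda>T_closed[OF i x] \<Gamma>U_closed[OF i z]]
        bounded_opsD(3)[OF T c x] bounded_opsD(3)[OF \<Lambda>[OF i] c bounded_opsD(1)[OF T x]] by simp
    then have "ip H z (S (c \<odot>\<^bsub>H\<^esub> x)) = cnj c * ip H z (S x)"
      using c x z by (simp add: S_weak(3) smult_clos infsum_cmult_right' cong: infsum_cong)
    then show "ip H z (S (c \<odot>\<^bsub>H\<^esub> x)) = ip H z (c \<odot>\<^bsub>H\<^esub> S x)"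
      using c x z by (simp add: ip_smult_right S_weak(1))
  qed (use c x S_weak(1) in \<open>auto simp: smult_clos\<close>)
qed

end

section \<open>Frame bounds\<close>

text \<open>Evaluate the controlled bound at the preimage of \<open>f\<close> under \<open>T\<close>.\<close>

lemma g_bessel_if_controlled:
  assumes H: "inner_product_space K H" and T: "T \<in> GL K H"
    and \<Lambda>: "controlled_g_bessel K H I E T \<Lambda>"
  shows "g_bessel K H I E \<Lambda>"
proof -
  interpret inner_product_space K H by (rule H)
  obtain B where "g_upper_bound H I E (\<lambda>i. \<Lambda> i \<circ> T) B"
    using \<Lambda> by (auto simp: controlled_g_bessel_def)
  then have B: "g_upper_bound H I E (\<lambda>i. \<Lambda> i \<circ> T) (max B 0)"
    by (rule g_upper_bound_mono) simp
  obtain R where R: "R \<in> bounded_ops K H H" and TR: "\<And>x. x \<in> carrier H \<Longrightarrow> T (R x) = x"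
    using T by (auto simp: GL_def)
  obtain C where C: "\<And>x. x \<in> carrier H \<Longrightarrow> hnorm H (R x) \<le> C * hnorm H x"
    using bounded_opsD(4)[OF R] by blast
  have "g_upper_bound H I E \<Lambda> (max B 0 * C\<^sup>2)"
    unfolding g_upper_bound_def
  proof (intro ballI)
    fix f assume f: "f \<in> carrier H"
    have Rf: "R f \<in> carrier H" by (rule bounded_opsD(1)[OF R f])
    have "(hnorm H (R f))\<^sup>2 \<le> (C * hnorm H f)\<^sup>2"
      using C[OF f] hnorm_nonneg[OF Rf] by (rule power_mono)
    then have "max B 0 * (hnorm H (R f))\<^sup>2 \<le> max B 0 * C\<^sup>2 * (hnorm H f)\<^sup>2"
      using mult_left_mono[of "(hnorm H (R f))\<^sup>2" "(C * hnorm H f)\<^sup>2" "max B 0"]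
      by (simp add: power_mult_distrib mult.assoc)
    then show "(\<lambda>i. (hnorm (E i) (\<Lambda> i f))\<^sup>2) summable_on I \<and>
        (\<Sum>\<^sub>\<infinity>i\<in>I. (hnorm (E i) (\<Lambda> i f))\<^sup>2) \<le> max B 0 * C\<^sup>2 * (hnorm H f)\<^sup>2"
      using B Rf TR[OF f] by (auto simp: g_upper_bound_def dest!: bspec[OF _ Rf])
  qed
  then show ?thesis using \<Lambda> by (auto simp: g_bessel_def controlled_g_bessel_def)
qed

lemma controlled_g_frameI:
  assumes H: "inner_product_space K H" and T: "T \<in> GL K H"
    and \<Lambda>: "controlled_g_bessel K H I E T \<Lambda>"
    and A: "0 < A" "g_lower_bound H I E (\<lambda>i. \<Lambda> i \<circ> T) A"
  shows "controlled_g_frame K H I E T \<Lambda>"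
proof -
  obtain B where "g_upper_bound H I E (\<lambda>i. \<Lambda> i \<circ> T) B"
    using \<Lambda> by (auto simp: controlled_g_bessel_def)
  then have "g_upper_bound H I E (\<lambda>i. \<Lambda> i \<circ> T) (max A B)"
    using inner_product_space.g_upper_bound_mono[OF H] by fastforce
  then show ?thesis
    using g_bessel_if_controlled[OF H T \<Lambda>] A
    unfolding controlled_g_frame_def by (meson max.cobounded1)
qed

text \<open>Squaring the product estimate and bounding one factor leaves \<open>n\<^sup>2\<close> on both sides, which
  cancels.\<close>

lemma lower_bound_from_product:
  fixes a b c D n :: real
  assumes "0 \<le> a" "0 \<le> b" "0 \<le> c" "0 < D" and b: "b \<le> D * n\<^sup>2"
    and prod: "c * n\<^sup>2 \<le> sqrt a * sqrt b"
  shows "c\<^sup>2 / D * n\<^sup>2 \<le> a"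
proof (cases "n = 0")
  case False
  have "(c * n\<^sup>2)\<^sup>2 \<le> (sqrt a * sqrt b)\<^sup>2"
    using prod assms by (intro power_mono) auto
  also have "\<dots> = a * b" using assms by (simp add: power_mult_distrib)
  also have "\<dots> \<le> a * (D * n\<^sup>2)" using b assms by (intro mult_left_mono) auto
  finally have "(c\<^sup>2 * n\<^sup>2) * n\<^sup>2 \<le> (a * D) * n\<^sup>2"
    by (simp add: power_mult_distrib power2_eq_square mult_ac)
  then have "c\<^sup>2 * n\<^sup>2 \<le> a * D" using False by (simp add: mult_le_cancel_right)
  then show ?thesis using \<open>0 < D\<close> by (simp add: field_simps)
qed (use assms in simp)

theorem proposition3p5:
  fixes K :: "complex set"
    and H :: "'a ip_module" and E :: "int \<Rightarrow> 'b ip_module" and I :: "int set"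
    and T U :: "'a \<Rightarrow> 'a" and \<Lambda> \<Gamma> :: "int \<Rightarrow> 'a \<Rightarrow> 'b" and \<epsilon> :: real
  assumes "hilbert_space K H" and "separable_space (htopology H)"
    and "\<And>i. i \<in> I \<Longrightarrow> hilbert_space K (E i)"
    and "T \<in> GL K H" and "U \<in> GL K H"
    and "controlled_g_bessel K H I E T \<Lambda>"
    and "controlled_g_bessel K H I E U \<Gamma>"
    and "0 < \<epsilon>" and "\<epsilon> < 1"
    and "\<And>f. f \<in> carrier H \<Longrightarrow>
           hnorm H (f \<ominus>\<^bsub>H\<^esub> controlled_op H I E T \<Gamma> \<Lambda> U f) \<le> \<epsilon> * hnorm H f"
  shows "controlled_g_frame K H I E T \<Lambda> \<and>
         controlled_g_frame K H I E U \<Gamma> \<and>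
         controlled_op H I E T \<Gamma> \<Lambda> U \<in> GL K H"
proof -
  interpret hilbert_space K H by fact
  have H: "inner_product_space K H" by (rule inner_product_space_axioms)
  have \<Lambda>: "\<And>i. i \<in> I \<Longrightarrow> \<Lambda> i \<in> bounded_ops K H (E i)"
    and \<Gamma>: "\<And>i. i \<in> I \<Longrightarrow> \<Gamma> i \<in> bounded_ops K H (E i)"
    using assms(6,7) by (auto simp: controlled_g_bessel_def)
  \<comment> \<open>Both Bessel bounds are enlarged to be at least 1, since they become denominators.\<close>
  obtain B0 where "g_upper_bound H I E (\<lambda>i. \<Lambda> i \<circ> T) B0"
    using assms(6) by (auto simp: controlled_g_bessel_def)
  then have B: "g_upper_bound H I E (\<lambda>i. \<Lambda> i \<circ> T) (max B0 1)"
    by (rule g_upper_bound_mono) simp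
  obtain D0 where "g_upper_bound H I E (\<lambda>i. \<Gamma> i \<circ> U) D0"
    using assms(7) by (auto simp: controlled_g_bessel_def)
  then have D: "g_upper_bound H I E (\<lambda>i. \<Gamma> i \<circ> U) (max D0 1)"
    by (rule g_upper_bound_mono) simp
  define B' D' where "B' = max B0 1" and "D' = max D0 1"
  interpret controlled_bessel_pair K H I E T U \<Lambda> \<Gamma> B' D'
    by (intro controlled_bessel_pair.intro controlled_bessel_pair_axioms.intro hilbert_space_axioms)
      (simp_all add: assms(3) GL_bounded[OF assms(4)] GL_bounded[OF assms(5)] \<Lambda> \<Gamma> B D B'_def D'_def)
  note near = assms(10)
  have GL: "S \<in> GL K H"
    by (rule near_identity_in_GL[OF S_weak(1) S_linear assms(9) near])
  define a where "a f = (\<Sum>\<^sub>\<infinity>i\<in>I. (hnorm (E i) (\<Lambda> i (T f)))\<^sup>2)" for f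
  define b where "b f = (\<Sum>\<^sub>\<infinity>i\<in>I. (hnorm (E i) (\<Gamma> i (U f)))\<^sup>2)" for f
  have nonneg: "0 \<le> a f" "0 \<le> b f" for f by (simp_all add: a_def b_def infsum_nonneg)
  have upper: "a f \<le> B' * (hnorm H f)\<^sup>2" "b f \<le> D' * (hnorm H f)\<^sup>2" if "f \<in> carrier H" for f
    using B D that by (simp_all add: g_upper_bound_def a_def b_def B'_def D'_def)
  \<comment> \<open>Testing \<open>S f\<close> against \<open>f\<close> rather than estimating its norm keeps both \<open>a f\<close> and \<open>b f\<close> in play,
    so that one inequality serves both families.\<close>
  have key: "(1 - \<epsilon>) * (hnorm H f)\<^sup>2 \<le> sqrt (a f) * sqrt (b f)" if f: "f \<in> carrier H" for f
  proof -
    have Sf: "S f \<in> carrier H" by (rule S_weak(1)[OF f])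
    have d: "f \<ominus>\<^bsub>H\<^esub> S f \<in> carrier H" using f Sf by (rule diff_closed)
    have "(hnorm H f)\<^sup>2 - Re (ip H f (S f)) = Re (ip H f (f \<ominus>\<^bsub>H\<^esub> S f))"
      using f Sf by (simp add: ip_diff_right ip_self[OF f])
    also have "\<dots> \<le> hnorm H f * hnorm H (f \<ominus>\<^bsub>H\<^esub> S f)"
      using cauchy_schwarz[OF f d] complex_Re_le_cmod order_trans by blast
    also have "\<dots> \<le> hnorm H f * (\<epsilon> * hnorm H f)"
      using near[OF f] hnorm_nonneg[OF f] by (rule mult_left_mono)
    finally have "(1 - \<epsilon>) * (hnorm H f)\<^sup>2 \<le> Re (ip H f (S f))"
      by (simp add: power2_eq_square algebra_simps)
    also have "\<dots> \<le> cmod (ip H f (S f))" by (rule complex_Re_le_cmod)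
    also have "\<dots> \<le> sqrt (a f) * sqrt (b f)"
      using S_weak(4)[OF f f] by (simp add: a_def b_def)
    finally show ?thesis .
  qed
  have "g_lower_bound H I E (\<lambda>i. \<Lambda> i \<circ> T) ((1 - \<epsilon>)\<^sup>2 / D')"
    unfolding g_lower_bound_def
  proof
    fix f assume f: "f \<in> carrier H"
    from lower_bound_from_product[OF nonneg _ bounds_pos(2) upper(2)[OF f] key[OF f]] assms(9)
    show "(1 - \<epsilon>)\<^sup>2 / D' * (hnorm H f)\<^sup>2 \<le>
        (\<Sum>\<^sub>\<infinity>i\<in>I. (hnorm (E i) ((\<Lambda> i \<circ> T) f))\<^sup>2)"
      by (simp add: a_def)
  qed
  moreover have "g_lower_bound H I E (\<lambda>i. \<Gamma> i \<circ> U) ((1 - \<epsilon>)\<^sup>2 / B')"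
    unfolding g_lower_bound_def
  proof
    fix f assume f: "f \<in> carrier H"
    have "(1 - \<epsilon>) * (hnorm H f)\<^sup>2 \<le> sqrt (b f) * sqrt (a f)"
      using key[OF f] by (simp add: mult.commute)
    from lower_bound_from_product[OF nonneg(2) nonneg(1) _ bounds_pos(1) upper(1)[OF f] this] assms(9)
    show "(1 - \<epsilon>)\<^sup>2 / B' * (hnorm H f)\<^sup>2 \<le>
        (\<Sum>\<^sub>\<infinity>i\<in>I. (hnorm (E i) ((\<Gamma> i \<circ> U) f))\<^sup>2)"
      by (simp add: b_def)
  qed
  moreover have "0 < (1 - \<epsilon>)\<^sup>2 / D'" "0 < (1 - \<epsilon>)\<^sup>2 / B'"
    using assms(9) bounds_pos by simp_all
  ultimately show ?thesis
    using controlled_g_frameI[OF H assms(4,6)] controlled_g_frameI[OF H assms(5,7)] GL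
    by simp
qed

end
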